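(* Let $(B,G)$ be an MV-pair. Then $\sim_G$ is an effect algebra congruence on $B$ (where $B$ is regarded as an effect algebra under disjoint join), and the quotient $B/\sim_G$ is an MV-effect algebra.
   Context: **Effect algebras.** An effect algebra is a partial algebra $(E;\oplus,0,1)$ with a binary partial operation $\oplus$ and constants $0,1$ such that: (E1) if $a\oplus b$ is defined, then $b\oplus a$ is defined and $a\oplus b=b\oplus a$; (E2) if $a\oplus b$ and $(a\oplus b)\oplus c$ are defined, then $b\oplus c$ and $a\oplus(b\oplus c)$ are defined and $(a\oplus b)\oplus c=a\oplus(b\oplus c)$; (E3) for every $a$ there is a unique $a'$ with $a\oplus a'=1$; (E4) if $a\oplus 1$ is defined, then $a=0$. One writes $a\le b$ iff there is $c$ with $a\oplus c=b$; this is a partial order with least element $0$ and greatest element $1$, and the element $c$ is unique and denoted $b\ominus a$. **MV-effect algebras.** An MV-effect algebra is an effect algebra $M$ which is a lattice in the order $\le$ and satisfies $(a\lor b)\ominus a=b\ominus(a\land b)$ for all $a,b\in M$. **Boolean algebras as effect algebras.** A Boolean algebra $B$ is an effect algebra with $a\oplus b$ defined iff $a\wedge b=0$, in which case $a\oplus b=a\vee b$; here $a'$ is the Boolean complement. **Congruences and quotients.** An effect algebra congruence on an effect algebra $E$ is a relation $\sim$ on $E$ such that: (C1) $\sim$ is an equivalence relation; (C2) if $a_1\sim a_2$, $b_1\sim b_2$ and $a_1\oplus b_1$, $a_2\oplus b_2$ exist, then $a_1\oplus b_1\sim a_2\oplus b_2$; (C5) if $a\sim b\oplus c$, then there are $b_1\sim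 b$, $c_1\sim c$ such that $b_1\oplus c_1$ exists and $a=b_1\oplus c_1$; (C6) if $a\sim b$, then $a'\sim b'$. On the quotient $E/\sim$, $[a]\oplus[b]$ is defined iff there are $a_1\sim a$, $b_1\sim b$ such that $a_1\oplus b_1$ is defined, and then $[a]\oplus[b]=[a_1\oplus b_1]$; the constants are $[0]$ and $[1]$. **MV-pairs.** Let $B$ be a Boolean algebra and $G$ a subgroup of its automorphism group $\mathrm{Aut}(B)$. For $a,b\in B$ write $a\sim_G b$ iff $b=f(a)$ for some $f\in G$, and let $L(a,b)=\{a\wedge f(b):f\in G\}$. For a poset $P$, $\mathrm{max}(P)$ denotes the set of maximal elements of $P$. The pair $(B,G)$ is an MV-pair iff: (MVP1) for all $a,b\in B$ and $f\in G$ such that $a\le b$ and $f(a)\le b$, there is $h\in G$ such that $h(a)=f(a)$ and $h(b)=b$; (MVP2) for all $a,b\in B$ and $x\in L(a,b)$, there exists $m\in\mathrm{max}(L(a,b))$ with $m\ge x$. *)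

theory Defs
  imports "HOL-Algebra.Group"
begin

section \<open>Effect algebras\<close>

text \<open>
  The partial operation is option-valued: \<open>eplus E a b = Some c\<close> says that the sum of \<open>a\<close> and \<open>b\<close>
  is defined and equal to \<open>c\<close>, and \<open>None\<close> says that it is undefined. Values of \<open>eplus\<close> outside
  the carrier are irrelevant.
\<close>

record 'a effalg = "'a partial_object" +
  eplus :: "'a \<Rightarrow> 'a \<Rightarrow> 'a option"
  ezero :: 'a
  eone  :: 'a

locale effect_algebra =
  fixes E :: "'a effalg"
  assumes zero_closed: "ezero E \<in> carrier E"
    and one_closed: "eone E \<in> carrier E"
    and plus_closed:
      "\<lbrakk>a \<in> carrier E; b \<in> carrier E; eplus E a b = Some c\<rbrakk> \<Longrightarrow> c \<in> carrier E"
    and E1: "\<lbrakk>a \<in> carrier E; b \<in> carrier E; eplus E a b = Some c\<rbrakk> \<Longrightarrow> eplus E b a = Some c"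
    and E2: "\<lbrakk>a \<in> carrier E; b \<in> carrier E; c \<in> carrier E;
              eplus E a b = Some d; eplus E d c = Some e\<rbrakk>
            \<Longrightarrow> \<exists>u. eplus E b c = Some u \<and> eplus E a u = Some e"
    and E3: "a \<in> carrier E \<Longrightarrow> \<exists>!a'. a' \<in> carrier E \<and> eplus E a a' = Some (eone E)"
    and E4: "\<lbrakk>a \<in> carrier E; eplus E a (eone E) = Some c\<rbrakk> \<Longrightarrow> a = ezero E"

definition ecompl :: "'a effalg \<Rightarrow> 'a \<Rightarrow> 'a" where
  "ecompl E a = (THE a'. a' \<in> carrier E \<and> eplus E a a' = Some (eone E))"

definition eminus :: "'a effalg \<Rightarrow> 'a \<Rightarrow> 'a \<Rightarrow> 'a" where
  "eminus E b a = (THE c. c \<in> carrier E \<and> eplus E a c = Some b)"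

definition eorder :: "'a effalg \<Rightarrow> 'a gorder" where
  "eorder E = \<lparr>carrier = carrier E, eq = (=),
               le = (\<lambda>a b. \<exists>c \<in> carrier E. eplus E a c = Some b)\<rparr>"

locale mv_effect_algebra = effect_algebra M for M :: "'a effalg" +
  assumes lattice: "lattice (eorder M)"
    and mv: "\<lbrakk>a \<in> carrier M; b \<in> carrier M\<rbrakk> \<Longrightarrow>
      eminus M (a \<squnion>\<^bsub>eorder M\<^esub> b) a = eminus M b (a \<sqinter>\<^bsub>eorder M\<^esub> b)"


section \<open>Congruences and quotients\<close>

locale effect_algebra_congruence = effect_algebra E for E :: "'a effalg" +
  fixes R :: "('a \<times> 'a) set"
  assumes C1: "equiv (carrier E) R"
    and C2: "\<lbrakk>(a1, a2) \<in> R; (b1, b2) \<in> R; eplus E a1 b1 = Some c1; eplus E a2 b2 = Some c2\<rbrakk>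
            \<Longrightarrow> (c1, c2) \<in> R"
    and C5: "\<lbrakk>b \<in> carrier E; c \<in> carrier E; eplus E b c = Some d; (a, d) \<in> R\<rbrakk>
            \<Longrightarrow> \<exists>b1 c1. (b1, b) \<in> R \<and> (c1, c) \<in> R \<and> eplus E b1 c1 = Some a"
    and C6: "(a, b) \<in> R \<Longrightarrow> (ecompl E a, ecompl E b) \<in> R"

text \<open>
  The class of the sum is picked by a definite description; by (C2) it does not depend on the
  summable representatives when \<open>R\<close> is a congruence.
\<close>

definition equot_plus ::
    "'a effalg \<Rightarrow> ('a \<times> 'a) set \<Rightarrow> 'a set \<Rightarrow> 'a set \<Rightarrow> 'a set option" where
  "equot_plus E R A B =
     (if \<exists>a1 \<in> A. \<exists>b1 \<in> B. eplus E a1 b1 \<noteq> None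
      then Some (THE C. \<exists>a1 \<in> A. \<exists>b1 \<in> B. \<exists>c. eplus E a1 b1 = Some c \<and> C = R `` {c})
      else None)"

definition equot :: "'a effalg \<Rightarrow> ('a \<times> 'a) set \<Rightarrow> 'a set effalg" where
  "equot E R = \<lparr>carrier = carrier E // R, eplus = equot_plus E R,
                ezero = R `` {ezero E}, eone = R `` {eone E}\<rparr>"


section \<open>Boolean algebras and MV-pairs\<close>

text \<open>
  Importing HOL-Algebra hides short names of class operations such as \<open>inf\<close> and \<open>top\<close>, hence the
  qualified names below. The Boolean algebra is the whole type, of class \<open>boolean_algebra\<close>.
\<close>

definition bool_effalg :: "'a::boolean_algebra effalg" where
  "bool_effalg =
     \<lparr>carrier = UNIV,
      eplus = (\<lambda>a b. if inf_class.inf a b = bot_class.bot then Some (sup_class.sup a b) else None),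
      ezero = bot_class.bot, eone = top_class.top\<rparr>"

definition bool_automorphism :: "('a::boolean_algebra \<Rightarrow> 'a) \<Rightarrow> bool" where
  "bool_automorphism f \<longleftrightarrow> bij f \<and>
     (\<forall>a b. f (inf_class.inf a b) = inf_class.inf (f a) (f b)) \<and>
     (\<forall>a b. f (sup_class.sup a b) = sup_class.sup (f a) (f b)) \<and>
     (\<forall>a. f (- a) = - f a) \<and> f bot_class.bot = bot_class.bot \<and> f top_class.top = top_class.top"

definition bool_Aut :: "('a::boolean_algebra \<Rightarrow> 'a) monoid" where
  "bool_Aut = \<lparr>carrier = {f. bool_automorphism f}, mult = (\<circ>), one = id\<rparr>"

lemma bool_automorphism_inv:
  assumes "bool_automorphism f"
  shows "bool_automorphism (Hilbert_Choice.inv f)"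
proof -
  have b: "bij f" using assms by (simp add: bool_automorphism_def)
  have eqI: "Hilbert_Choice.inv f x = y" if "f y = x" for x y
    using b that by (metis bij_inv_eq_iff)
  have ff: "f (Hilbert_Choice.inv f x) = x" for x
    using b by (simp add: bij_is_surj surj_f_inv_f)
  show ?thesis
    using assms b unfolding bool_automorphism_def
    by (auto intro!: eqI bij_imp_bij_inv simp: ff)
qed

lemma group_bool_Aut: "group (bool_Aut :: ('a::boolean_algebra \<Rightarrow> 'a) monoid)"
proof (rule groupI)
  fix f :: "'a \<Rightarrow> 'a" assume "f \<in> carrier bool_Aut"
  then have f: "bool_automorphism f" by (simp add: bool_Aut_def)
  then have "Hilbert_Choice.inv f \<circ> f = id"
    by (simp add: bool_automorphism_def bij_is_inj)
  then show "\<exists>g \<in> carrier bool_Aut. g \<otimes>\<^bsub>bool_Aut\<^esub> f = \<one>\<^bsub>bool_Aut\<^esub>"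
    using bool_automorphism_inv[OF f] by (auto simp: bool_Aut_def)
qed (auto simp: bool_Aut_def bool_automorphism_def bij_comp comp_assoc)

definition sim_rel :: "('a::boolean_algebra \<Rightarrow> 'a) set \<Rightarrow> ('a \<times> 'a) set" where
  "sim_rel G = {(a, b). \<exists>f \<in> G. b = f a}"

definition L_set :: "('a::boolean_algebra \<Rightarrow> 'a) set \<Rightarrow> 'a \<Rightarrow> 'a \<Rightarrow> 'a set" where
  "L_set G a b = {inf_class.inf a (f b) | f. f \<in> G}"

definition max_elems :: "'a::order set \<Rightarrow> 'a set" where
  "max_elems P = {m \<in> P. \<forall>x \<in> P. m \<le> x \<longrightarrow> x = m}"

locale mv_pair =
  fixes G :: "('a::boolean_algebra \<Rightarrow> 'a) set"
  assumes subgroup: "subgroup G bool_Aut"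
    and MVP1: "\<lbrakk>f \<in> G; a \<le> b; f a \<le> b\<rbrakk> \<Longrightarrow> \<exists>h \<in> G. h a = f a \<and> h b = b"
    and MVP2: "x \<in> L_set G a b \<Longrightarrow> \<exists>m \<in> max_elems (L_set G a b). x \<le> m"

end

theory Submission
  imports Defs
begin

text \<open>
  By (MVP1), two pairs of equivalent elements lying below a common bound can be matched by an
  automorphism fixing that bound; this gives the congruence laws, and antisymmetry of the quotient
  order. The heart of the matter is that any two maximal elements of \<open>L(a, b)\<close> are equivalent.
  If \<open>a \<and> b\<close> is itself maximal, then no nonzero part of \<open>a - b\<close> is equivalent to a part of
  \<open>b - a\<close>, for otherwise \<open>b\<close> could be moved by \<open>G\<close>, fixing \<open>a \<and> b\<close>, so as to enlarge the
  intersection with \<open>a\<close>. Given another maximal element \<open>n\<close>, one moves it by an automorphism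
  fixing \<open>a\<close> until its intersection with \<open>a \<and> b\<close> is maximal too; its remainder is then orthogonal
  to both pieces of a part of \<open>b\<close> into which it can be moved, and hence vanishes.
  Consequently every pair of classes has representatives \<open>a, b\<close> with \<open>a \<and> b\<close> maximal in
  \<open>L(a, b)\<close>, and for these the meet, the join and the differences in the quotient are the classes
  of \<open>a \<and> b\<close>, \<open>a \<or> b\<close> and of the Boolean differences.
\<close>

notation inf_class.inf (infixl "\<^bold>\<and>" 70)
notation sup_class.sup (infixl "\<^bold>\<or>" 65)

section \<open>Boolean algebras as effect algebras\<close>

lemma carrier_bool_effalg [simp]: "carrier bool_effalg = UNIV"
  and ezero_bool_effalg [simp]: "ezero bool_effalg = bot_class.bot"
  and eone_bool_effalg [simp]: "eone bool_effalg = top_class.top"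
  by (simp_all add: bool_effalg_def)

text \<open>Disjointness is turned into an inequality because (MVP1) speaks of elements below a
  bound; here the bound is a complement.\<close>

lemma eplus_bool_effalg [simp]:
  "eplus bool_effalg a b = Some c \<longleftrightarrow> a \<le> - b \<and> c = a \<^bold>\<or> b"
  by (auto simp: bool_effalg_def inf_shunt)

lemma le_uminus_commute: "a \<le> - b \<longleftrightarrow> b \<le> - a" for a b :: "'a::boolean_algebra"
  by (metis inf_commute inf_shunt)

text \<open>The left side is what \<open>eplus_bool_effalg\<close> makes of a sum equal to the unit,
  so this yields (E3) and the value of \<open>ecompl\<close>.\<close>

lemma disjoint_complement_iff:
  fixes a b :: "'a::boolean_algebra"
  shows "a \<le> - b \<and> top_class.top = a \<^bold>\<or> b \<longleftrightarrow> b = - a"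
  by (metis compl_unique double_compl inf_shunt order_refl sup_compl_top)

lemma le_sup_diff: "a \<le> b \<Longrightarrow> a \<^bold>\<or> (b - a) = b" for a b :: "'a::boolean_algebra"
  by (simp add: boolean_algebra_class.diff_eq sup_inf_distrib1 sup_absorb2)

lemma diff_le_uminus: "b - a \<le> - a" "a \<le> - (b - a)" for a b :: "'a::boolean_algebra"
  by (simp_all add: boolean_algebra_class.diff_eq)

lemma effect_algebra_bool: "effect_algebra (bool_effalg :: 'a::boolean_algebra effalg)"
proof
  fix a b c d e :: 'a
  assume "eplus bool_effalg a b = Some d" "eplus bool_effalg d c = Some e"
  then show "\<exists>u. eplus bool_effalg b c = Some u \<and> eplus bool_effalg a u = Some e"
    by (auto simp: sup_assoc)
next
  fix a b c :: 'a
  assume "eplus bool_effalg a b = Some c"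
  then show "eplus bool_effalg b a = Some c"
    by (simp add: sup_commute le_uminus_commute)
next
  fix a :: 'a
  show "\<exists>!a'. a' \<in> carrier bool_effalg \<and> eplus bool_effalg a a' = Some (eone bool_effalg)"
    by (simp add: disjoint_complement_iff)
next
  fix a c :: 'a
  assume "eplus bool_effalg a (eone bool_effalg) = Some c"
  then show "a = ezero bool_effalg" by (simp add: bot_unique)
qed simp_all

lemma ecompl_bool_effalg [simp]: "ecompl bool_effalg a = - a"
  by (simp add: ecompl_def disjoint_complement_iff)

lemma max_elemsD: "m \<in> max_elems P \<Longrightarrow> x \<in> P \<Longrightarrow> m \<le> x \<Longrightarrow> x = m"
  and max_elems_in: "m \<in> max_elems P \<Longrightarrow> m \<in> P"
  by (simp_all add: max_elems_def)

section \<open>The action of \<open>G\<close>, its orbits and the congruence laws\<close>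

context mv_pair
begin

lemma
  assumes "f \<in> G"
  shows map_inf: "f (a \<^bold>\<and> b) = f a \<^bold>\<and> f b"
    and map_sup: "f (a \<^bold>\<or> b) = f a \<^bold>\<or> f b"
    and map_uminus: "f (- a) = - f a"
    and map_bot: "f bot_class.bot = bot_class.bot"
    and map_top: "f top_class.top = top_class.top"
    and map_bij: "bij f"
  using subgroup.subset[OF subgroup] assms by (auto simp: bool_Aut_def bool_automorphism_def)

lemma map_diff: "f \<in> G \<Longrightarrow> f (a - b) = f a - f b"
  by (simp add: boolean_algebra_class.diff_eq map_inf map_uminus)

lemma map_mono: "f \<in> G \<Longrightarrow> a \<le> b \<Longrightarrow> f a \<le> f b"
  by (metis map_inf le_iff_inf)

lemma id_mem: "id \<in> G"
  using subgroup.one_closed[OF subgroup] by (simp add: bool_Aut_def)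

lemma comp_mem: "f \<in> G \<Longrightarrow> g \<in> G \<Longrightarrow> f \<circ> g \<in> G"
  using subgroup.m_closed[OF subgroup] by (simp add: bool_Aut_def)

lemma inverse_mem:
  assumes "f \<in> G"
  obtains g where "g \<in> G" "\<forall>x. g (f x) = x" "\<forall>x. f (g x) = x"
proof
  let ?g = "m_inv bool_Aut f"
  interpret group "bool_Aut :: ('a \<Rightarrow> 'a) monoid" by (rule group_bool_Aut)
  have f: "f \<in> carrier bool_Aut" using subgroup.subset[OF subgroup] assms by blast
  show "?g \<in> G" using subgroup.m_inv_closed[OF subgroup assms] .
  show "\<forall>x. ?g (f x) = x" "\<forall>x. f (?g x) = x"
    using l_inv[OF f] r_inv[OF f] by (simp_all add: bool_Aut_def fun_eq_iff)
qed

abbreviation sim (infix "\<sim>" 50) where "a \<sim> b \<equiv> (a, b) \<in> sim_rel G"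

lemma simI: "f \<in> G \<Longrightarrow> a \<sim> f a"
  by (auto simp: sim_rel_def)

lemma simE: assumes "a \<sim> b" obtains f where "f \<in> G" "b = f a"
  using assms by (auto simp: sim_rel_def)

lemma sim_refl [simp]: "a \<sim> a"
  using simI[OF id_mem] by simp

lemma sim_sym: "a \<sim> b \<Longrightarrow> b \<sim> a"
  by (metis simE simI inverse_mem)

lemma sim_trans [trans]: "a \<sim> b \<Longrightarrow> b \<sim> c \<Longrightarrow> a \<sim> c"
  by (metis simE simI comp_mem comp_apply)

lemma equiv_sim: "equiv UNIV (sim_rel G)"
  by (auto intro!: equivI refl_onI symI transI intro: sim_sym sim_trans)

text \<open>(MVP1) with bound \<open>f a\<close> gives \<open>h\<close> sending both
  \<open>a\<close> and \<open>f a\<close> to \<open>f a\<close>, and \<open>h\<close> is injective.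
  Antisymmetry of the quotient order rests on this.\<close>

lemma not_expanding: "f \<in> G \<Longrightarrow> a \<le> f a \<Longrightarrow> f a = a"
  by (metis MVP1 order_refl map_bij bij_is_inj inj_eq)

text \<open>An automorphism fixing \<open>- b\<close> fixes \<open>b\<close>, so (MVP1) with bound
  \<open>- b\<close> can move \<open>a\<close> while a disjoint element stays in place.\<close>

lemma MVP1_disjoint:
  assumes "f \<in> G" "a \<le> - b" "f a \<le> - b"
  obtains h where "h \<in> G" "h a = f a" "h b = b"
  using MVP1[OF assms] by (metis map_uminus double_compl)

text \<open>Pulling \<open>a2\<close> and \<open>b2\<close> back along the inverse \<open>k\<close>
  of \<open>g\<close> makes the second summands equal. Then \<open>a1\<close> and
  \<open>k a2\<close> both avoid \<open>b1\<close>, so some \<open>h\<close> fixing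
  \<open>b1\<close> matches them, and \<open>g\<close> carries the result forward.\<close>

lemma sim_sup:
  assumes "a1 \<sim> a2" "b1 \<sim> b2" "a1 \<le> - b1" "a2 \<le> - b2"
  shows "a1 \<^bold>\<or> b1 \<sim> a2 \<^bold>\<or> b2"
proof -
  obtain f where f: "f \<in> G" "a2 = f a1" using assms(1) by (rule simE)
  obtain g where g: "g \<in> G" "b2 = g b1" using assms(2) by (rule simE)
  obtain k where k: "k \<in> G" "\<forall>x. k (g x) = x" "\<forall>x. g (k x) = x"
    by (rule inverse_mem[OF g(1)])
  have "k a2 \<le> - b1"
    using map_mono[OF k(1) assms(4)] by (simp add: map_uminus k g(2))
  then obtain h where h: "h \<in> G" "h a1 = (k \<circ> f) a1" "h b1 = b1"
    using MVP1_disjoint[of "k \<circ> f" a1 b1] comp_mem k f assms(3) by auto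
  have "(g \<circ> h) (a1 \<^bold>\<or> b1) = a2 \<^bold>\<or> b2"
    using h f g k by (simp add: map_sup)
  then show ?thesis using simI[OF comp_mem[OF g(1) h(1)]] by metis
qed

lemma sim_sup_split:
  assumes "a \<sim> b \<^bold>\<or> c" "b \<le> - c"
  obtains b1 c1 where "b1 \<sim> b" "c1 \<sim> c" "b1 \<le> - c1" "a = b1 \<^bold>\<or> c1"
proof -
  obtain f where f: "f \<in> G" "a = f (b \<^bold>\<or> c)" using sim_sym[OF assms(1)] by (rule simE)
  show ?thesis
  proof
    show "f b \<sim> b" "f c \<sim> c" using simI[OF f(1)] sim_sym by blast+
    show "f b \<le> - f c" using map_mono[OF f(1) assms(2)] by (simp add: map_uminus f(1))
    show "a = f b \<^bold>\<or> f c" using f by (simp add: map_sup)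
  qed
qed

lemma sim_uminus: "a \<sim> b \<Longrightarrow> - a \<sim> - b"
  by (metis simE simI map_uminus)

lemma sim_top: "top_class.top \<sim> a \<longleftrightarrow> a = top_class.top"
  by (metis simE sim_refl map_top)

theorem congruence: "effect_algebra_congruence bool_effalg (sim_rel G)"
proof (intro effect_algebra_congruence.intro effect_algebra_bool
    effect_algebra_congruence_axioms.intro)
  fix a1 a2 b1 b2 c1 c2 :: 'a
  assume "a1 \<sim> a2" "b1 \<sim> b2" "eplus bool_effalg a1 b1 = Some c1" "eplus bool_effalg a2 b2 = Some c2"
  then show "c1 \<sim> c2" by (simp add: sim_sup)
next
  fix a b c d :: 'a
  assume "eplus bool_effalg b c = Some d" "a \<sim> d"
  then show "\<exists>b1 c1. b1 \<sim> b \<and> c1 \<sim> c \<and> eplus bool_effalg b1 c1 = Some a"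
    using sim_sup_split[of a b c] by (auto simp: sim_rel_def) metis
qed (simp_all add: equiv_sim sim_uminus)


section \<open>Maximal elements of \<open>L(a, b)\<close>\<close>

lemma L_setI: "f \<in> G \<Longrightarrow> a \<^bold>\<and> f b \<in> L_set G a b"
  by (auto simp: L_set_def)

lemma L_setE: assumes "x \<in> L_set G a b" obtains f where "f \<in> G" "x = a \<^bold>\<and> f b"
  using assms by (auto simp: L_set_def)

text \<open>Only the starting point in the orbit of \<open>b\<close> changes. Hence \<open>b\<close>
  may be replaced by an equivalent element without affecting maximality.\<close>

lemma L_set_map:
  assumes "f \<in> G" shows "L_set G a (f b) = L_set G a b"
proof -
  have sub: "L_set G a (f b) \<subseteq> L_set G a b" if f: "f \<in> G" for f b
  proof
    fix x assume "x \<in> L_set G a (f b)"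
    then obtain g where "g \<in> G" "x = a \<^bold>\<and> g (f b)" by (rule L_setE)
    then show "x \<in> L_set G a b" using L_setI[OF comp_mem[OF _ f], of g] by simp
  qed
  obtain g where g: "g \<in> G" "\<forall>x. g (f x) = x" "\<forall>x. f (g x) = x"
    by (rule inverse_mem[OF assms])
  show ?thesis using sub[OF assms, of b] sub[OF g(1), of "f b"] g by simp
qed

lemma maximal_orthogonal:
  assumes max: "a \<^bold>\<and> b \<in> max_elems (L_set G a b)" and f: "f \<in> G"
  shows "(a - b) \<^bold>\<and> f (b - a) = bot_class.bot"
proof -
  define u where "u = (a - b) \<^bold>\<and> f (b - a)"
  obtain g where g: "g \<in> G" "\<forall>x. g (f x) = x" "\<forall>x. f (g x) = x"
    by (rule inverse_mem[OF f])
  have "g u \<le> g (f (b - a))" by (rule map_mono[OF g(1)]) (simp add: u_def)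
  then have gu: "g u \<le> b - a" by (simp add: g)
  have u: "u \<le> a - b" by (simp add: u_def)
  have "g u \<le> - (a \<^bold>\<and> b)" "f (g u) \<le> - (a \<^bold>\<and> b)"
    using gu u by (auto simp: boolean_algebra_class.diff_eq g intro: le_supI1 le_supI2)
  \<comment> \<open>Neither \<open>g u\<close> nor its image \<open>u\<close> meets
    \<open>a \<and> b\<close>, so the first can be moved to the second with
    \<open>a \<and> b\<close> fixed.\<close>
  then obtain h where h: "h \<in> G" "h (g u) = u" "h (a \<^bold>\<and> b) = a \<^bold>\<and> b"
    using MVP1_disjoint[OF f] g by metis
  have "g u \<le> b" using gu by (simp add: boolean_algebra_class.diff_eq)
  then have "u \<le> h b" using map_mono[OF h(1)] h(2) by metis
  moreover have "a \<^bold>\<and> b \<le> h b" using map_mono[OF h(1), of "a \<^bold>\<and> b" b] h(3) by simp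
  \<comment> \<open>As \<open>u\<close> lies below both \<open>a\<close> and \<open>h b\<close>,
    this equality forces it into \<open>a \<and> b\<close>, although it avoids
    \<open>b\<close>.\<close>
  then have "a \<^bold>\<and> h b = a \<^bold>\<and> b"
    using max_elemsD[OF max L_setI[OF h(1)]] by simp
  ultimately have "u \<le> a \<^bold>\<and> b" using u by (metis boolean_algebra_class.diff_eq le_inf_iff)
  moreover have "u \<le> - b" using u by (simp add: boolean_algebra_class.diff_eq)
  ultimately show ?thesis unfolding u_def[symmetric]
    by (metis bot_unique inf_compl_bot le_inf_iff)
qed

lemma maximal_sim_inf:
  assumes m: "a \<^bold>\<and> b \<in> max_elems (L_set G a b)" and n: "n \<in> max_elems (L_set G a b)"
  shows "a \<^bold>\<and> b \<sim> n"
proof -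
  define m where "m = a \<^bold>\<and> b"
  obtain g where g: "g \<in> G" "n = a \<^bold>\<and> g b" using max_elems_in[OF n] by (rule L_setE)
  \<comment> \<open>\<open>L(m, n)\<close> is nonempty, so (MVP2) supplies a maximal overlap
    \<open>e\<close> of \<open>m\<close> with the images of \<open>n\<close>.\<close>
  have "m \<^bold>\<and> n \<in> L_set G m n" using L_setI[OF id_mem, of m n] by simp
  then obtain e where e: "e \<in> max_elems (L_set G m n)" using MVP2 by blast
  obtain h where h: "h \<in> G" "e = m \<^bold>\<and> h n" using max_elems_in[OF e] by (rule L_setE)
  obtain h' where h': "h' \<in> G" "\<forall>x. h' (h x) = x" "\<forall>x. h (h' x) = x"
    by (rule inverse_mem[OF h(1)])
  have e_a: "e \<le> a" by (simp add: h m_def le_infI1)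
  have h'e: "h' e \<le> n" using map_mono[OF h'(1), of e "h n"] h h' by simp
  have "h' e \<le> a" using h'e by (simp add: g)
  \<comment> \<open>\<open>h\<close> may move \<open>a\<close>. Since \<open>h' e\<close> and
    \<open>e\<close> both lie below \<open>a\<close>, (MVP1) trades \<open>h\<close> for
    \<open>k\<close>, which fixes \<open>a\<close> and still maps \<open>h' e\<close> to
    \<open>e\<close>.\<close>
  then obtain k where k: "k \<in> G" "k (h' e) = e" "k a = a"
    using MVP1[OF h(1), of "h' e" a] e_a h' by metis
  have e_kn: "e \<le> k n" using map_mono[OF k(1) h'e] k by simp
  have kn: "k n = a \<^bold>\<and> k (g b)" using k g by (simp add: map_inf)
  have mkn: "m \<^bold>\<and> k n = e"
    using max_elemsD[OF e L_setI[OF k(1)]] e_kn h by simp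
  have orth1: "(m - k n) \<^bold>\<and> f (k n - m) = bot_class.bot" if "f \<in> G" for f
    by (rule maximal_orthogonal[OF _ that]) (use e mkn L_set_map[OF k(1)] in simp)
  have orth2: "(a - b) \<^bold>\<and> f (b - a) = bot_class.bot" if "f \<in> G" for f
    by (rule maximal_orthogonal[OF assms(1) that])
  \<comment> \<open>The aim is that \<open>x\<close> vanishes, that is,
    \<open>k n \<le> m\<close>.\<close>
  define x where "x = k n - m"
  have "x \<le> - (a \<^bold>\<and> b) \<^bold>\<and> a"
    by (simp add: x_def kn m_def boolean_algebra_class.diff_eq le_infI1)
  also have "\<dots> \<le> - b" by (simp add: shunt1)
  finally have x_le: "x \<le> a - b"
    by (simp add: x_def kn boolean_algebra_class.diff_eq le_infI1)
  \<comment> \<open>\<open>q\<close> undoes \<open>k \<circ> g\<close> and so carries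
    \<open>k n\<close> into \<open>b\<close>, but it may move \<open>e\<close>. Correcting it by
    \<open>r\<close>, which fixes \<open>b\<close>, gives \<open>p\<close>, which carries
    \<open>k n\<close> into \<open>b\<close> and fixes \<open>e\<close>.\<close>
  obtain q where q: "q \<in> G" "\<forall>x. q (k (g x)) = x" "\<forall>x. k (g (q x)) = x"
    by (rule inverse_mem[OF comp_mem[OF k(1) g(1)], unfolded comp_apply])
  have qkn: "q (k n) \<le> b" using map_mono[OF q(1), of "k n" "k (g b)"] kn q by simp
  have "q e \<le> b" using map_mono[OF q(1) e_kn] qkn by simp
  have e_b: "e \<le> b" by (simp add: h m_def le_infI1)
  obtain q' where q': "q' \<in> G" "\<forall>x. q' (q x) = x" "\<forall>x. q (q' x) = x"
    by (rule inverse_mem[OF q(1)])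
  obtain r where r: "r \<in> G" "r (q e) = e" "r b = b"
    using MVP1[OF q'(1) \<open>q e \<le> b\<close>] q' e_b by metis
  define p where "p = r \<circ> q"
  have p: "p \<in> G" "p e = e" "p (k n) \<le> b"
    using comp_mem[OF r(1) q(1)] r map_mono[OF r(1) qkn] by (simp_all add: p_def)
  have "x = k n - e" unfolding x_def mkn[symmetric] boolean_algebra_class.diff_eq
    by (simp add: inf_sup_distrib1)
  then have "p x = p (k n) - e" using p by (simp add: map_diff)
  also have "\<dots> \<le> b - e" using p(3) by (simp add: boolean_algebra_class.diff_eq le_infI1)
  \<comment> \<open>Outside \<open>e = m \<and> k n\<close>, the element \<open>b\<close> consists
    of a part outside \<open>a\<close> and a part of \<open>m\<close> outside \<open>k n\<close>. By
    \<open>orth2\<close> and \<open>orth1\<close>, \<open>p x\<close> is disjoint from both.\<close>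
  also have "b - e \<le> (b - a) \<^bold>\<or> (m - k n)"
    unfolding mkn[symmetric] m_def boolean_algebra_class.diff_eq shunt2[symmetric]
    by (simp add: inf_sup_distrib1 inf_sup_distrib2 ac_simps le_infI2)
  finally have px: "p x \<le> (b - a) \<^bold>\<or> (m - k n)" .
  obtain p' where p': "p' \<in> G" "\<forall>x. p (p' x) = x" "\<forall>x. p' (p x) = x"
    by (rule inverse_mem[OF p(1)])
  have "x \<^bold>\<and> p' (b - a) = bot_class.bot"
    using orth2[OF p'(1)] x_le by (metis inf_mono bot_unique order_refl)
  then have "p (x \<^bold>\<and> p' (b - a)) = bot_class.bot" by (simp add: map_bot p)
  then have "p x \<^bold>\<and> (b - a) = bot_class.bot" by (simp add: map_inf p p')
  moreover have "p x \<^bold>\<and> (m - k n) = bot_class.bot"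
    using orth1[OF p(1)] by (simp add: x_def inf_commute)
  ultimately have "p x = bot_class.bot"
    using px by (metis inf_absorb1 inf_sup_distrib1 sup_bot_left)
  then have "x = bot_class.bot" by (metis map_bot map_bij p(1) bij_is_inj inj_eq)
  then have "k n \<le> m" by (simp add: x_def)
  obtain k' where k': "k' \<in> G" "\<forall>x. k' (k x) = x" "\<forall>x. k (k' x) = x"
    by (rule inverse_mem[OF k(1)])
  \<comment> \<open>\<open>k'\<close> fixes \<open>a\<close> as well, so \<open>k' m\<close> belongs
    to \<open>L(a, b)\<close> and maximality of \<open>n\<close> applies.\<close>
  have "k' m = a \<^bold>\<and> k' b" unfolding m_def using k' k by (metis map_inf)
  moreover have "n \<le> k' m" using map_mono[OF k'(1) \<open>k n \<le> m\<close>] k' by simp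
  ultimately have "k' m = n" using max_elemsD[OF n L_setI[OF k'(1)]] by simp
  then show ?thesis using simI[OF k'(1), of m] by (simp add: m_def)
qed

text \<open>The copy \<open>f x\<close> below \<open>a\<close> also lies below an image of
  \<open>b\<close>, hence below a maximal element of \<open>L(a, b)\<close>; that element is
  equivalent to \<open>a \<and> b\<close>.\<close>

lemma maximal_greatest:
  assumes m: "a \<^bold>\<and> b \<in> max_elems (L_set G a b)" and "f \<in> G" "f x \<le> a" "g \<in> G" "g x \<le> b"
  shows "\<exists>h\<in>G. h x \<le> a \<^bold>\<and> b"
proof -
  obtain g' where g': "g' \<in> G" "\<forall>x. g' (g x) = x" "\<forall>x. g (g' x) = x"
    by (rule inverse_mem[OF assms(4)])
  have "f x \<le> (f \<circ> g') b"
    using map_mono[OF assms(2) map_mono[OF g'(1) assms(5)]] g' by simp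
  moreover obtain n where n: "n \<in> max_elems (L_set G a b)" "a \<^bold>\<and> (f \<circ> g') b \<le> n"
    using MVP2 L_setI comp_mem assms(2) g'(1) by meson
  ultimately have "f x \<le> n" using assms(3) by (meson le_infI order_trans)
  obtain s where s: "s \<in> G" "a \<^bold>\<and> b = s n"
    using sim_sym[OF maximal_sim_inf[OF m n(1)]] by (rule simE)
  have "(s \<circ> f) x \<le> a \<^bold>\<and> b" using map_mono[OF s(1) \<open>f x \<le> n\<close>] s by simp
  then show ?thesis using comp_mem s assms(2) by blast
qed

text \<open>After moving the bound, \<open>a\<close> itself lies below it. Two uses of (MVP1) then
  adjust the copy of \<open>b\<close> below the bound: first to fix \<open>a \<and> b\<close>, then
  to match the remainders while fixing \<open>a\<close>.\<close>

lemma maximal_least: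
  assumes m: "a \<^bold>\<and> b \<in> max_elems (L_set G a b)" and "f \<in> G" "f a \<le> c" "g \<in> G" "g b \<le> c"
  shows "\<exists>h\<in>G. h (a \<^bold>\<or> b) \<le> c"
proof -
  obtain f' where f': "f' \<in> G" "\<forall>x. f' (f x) = x" "\<forall>x. f (f' x) = x"
    by (rule inverse_mem[OF assms(2)])
  define d where "d = f' c"
  define w where "w = f' \<circ> g"
  have w: "w \<in> G" using comp_mem f' assms by (simp add: w_def)
  have ad: "a \<le> d" using map_mono[OF f'(1) assms(3)] f' by (simp add: d_def)
  have wd: "w b \<le> d" using map_mono[OF f'(1) assms(5)] by (simp add: d_def w_def)
  obtain w' where w': "w' \<in> G" "\<forall>x. w' (w x) = x" "\<forall>x. w (w' x) = x"
    by (rule inverse_mem[OF w])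
  define m where "m = a \<^bold>\<and> b"
  have md: "m \<le> d" "w m \<le> d" using ad wd map_mono[OF w, of m b]
    by (auto simp: m_def intro: le_infI1 order_trans)
  \<comment> \<open>\<open>h\<close> brings \<open>w m\<close> back to \<open>m\<close> without
    moving the bound, so \<open>v\<close> fixes \<open>m\<close> and still sends \<open>b\<close>
    below \<open>d\<close>.\<close>
  obtain h where h: "h \<in> G" "h (w m) = m" "h d = d"
    using MVP1[OF w'(1) md(2)] md(1) w' by metis
  define v where "v = h \<circ> w"
  have v: "v \<in> G" "v m = m" "v b \<le> d"
    using comp_mem h w map_mono[OF h(1) wd] by (simp_all add: v_def)
  have "m \<le> v b" using map_mono[OF v(1), of m b] v by (simp add: m_def)
  \<comment> \<open>Maximality rules out further overlap, so \<open>v b - m\<close> avoids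
    \<open>a\<close> just as \<open>b - m\<close> does.\<close>
  then have avb: "a \<^bold>\<and> v b = m"
    using max_elemsD[OF assms(1) L_setI[OF v(1)]] by (simp add: m_def)
  have vbm: "v (b - m) = v b - m" using v by (simp add: map_diff)
  have "b - m \<le> - a" "v b - m \<le> - a"
    unfolding m_def boolean_algebra_class.diff_eq
     apply (simp add: inf_sup_distrib1)
    using avb unfolding m_def
    by (metis inf_commute inf_compl_bot inf_assoc inf_shunt)
  then obtain k where k: "k \<in> G" "k (b - m) = v b - m" "k a = a"
    using MVP1_disjoint[OF v(1), of "b - m" a] vbm by metis
  have "a \<^bold>\<or> (b - m) = a \<^bold>\<or> b"
    unfolding m_def boolean_algebra_class.diff_eq
    by (simp add: inf_sup_distrib1 sup_inf_distrib1)
  then have "k (a \<^bold>\<or> b) = a \<^bold>\<or> (v b - m)" using k map_sup[OF k(1)] by metis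
  also have "\<dots> \<le> d" using ad v(3) by (simp add: boolean_algebra_class.diff_eq le_infI1)
  finally have "(f \<circ> k) (a \<^bold>\<or> b) \<le> c" using map_mono[OF assms(2)] f' by (fastforce simp: d_def)
  then show ?thesis using comp_mem assms(2) k(1) by blast
qed

text \<open>Moving the second element alone suffices to make the meet maximal; meets and joins of
  classes are computed on such pairs.\<close>

lemma maximal_representative:
  obtains b' where "b' \<sim> b" "a \<^bold>\<and> b' \<in> max_elems (L_set G a b')"
proof -
  obtain n where n: "n \<in> max_elems (L_set G a b)" using MVP2 L_setI[OF id_mem] by blast
  obtain g where "g \<in> G" "n = a \<^bold>\<and> g b" using max_elems_in[OF n] by (rule L_setE)
  then show ?thesis using that[of "g b"] n by (simp add: L_set_map simI sim_sym)
qed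


section \<open>The quotient\<close>

definition cls :: "'a \<Rightarrow> 'a set" where "cls a = sim_rel G `` {a}"

abbreviation Q where "Q \<equiv> equot bool_effalg (sim_rel G)"

lemma cls_eq_iff: "cls a = cls b \<longleftrightarrow> a \<sim> b"
  unfolding cls_def using eq_equiv_class_iff[OF equiv_sim] by simp

lemma mem_cls: "x \<in> cls a \<longleftrightarrow> x \<sim> a"
  unfolding cls_def using sim_sym by auto

lemma carrier_Q: "carrier Q = range cls"
  by (auto simp: equot_def quotient_def cls_def)

lemma ezero_Q: "ezero Q = cls bot_class.bot" and eone_Q: "eone Q = cls top_class.top"
  by (simp_all add: equot_def cls_def)

text \<open>The definite description in \<open>equot_plus\<close> has exactly one value when some
  representatives are summable, since by \<open>sim_sup\<close> the class of the sum does not depend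
  on them.\<close>

lemma eplus_Q: "eplus Q (cls a) (cls b) = Some C \<longleftrightarrow>
   (\<exists>a1 b1. a1 \<sim> a \<and> b1 \<sim> b \<and> a1 \<le> - b1 \<and> C = cls (a1 \<^bold>\<or> b1))"
proof -
  have the: "(THE D. \<exists>a1 \<in> cls a. \<exists>b1 \<in> cls b. \<exists>c. eplus bool_effalg a1 b1 = Some c \<and> D = sim_rel G `` {c})
      = cls (a1 \<^bold>\<or> b1)" if "a1 \<sim> a" "b1 \<sim> b" "a1 \<le> - b1" for a1 b1
  proof (rule the_equality)
    show "\<exists>x\<in>cls a. \<exists>y\<in>cls b. \<exists>c. eplus bool_effalg x y = Some c
        \<and> cls (a1 \<^bold>\<or> b1) = sim_rel G `` {c}"
      using that unfolding cls_def[symmetric] eplus_bool_effalg by (metis mem_cls)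
  next
    fix D assume "\<exists>x\<in>cls a. \<exists>y\<in>cls b. \<exists>c. eplus bool_effalg x y = Some c \<and> D = sim_rel G `` {c}"
    then obtain x y where xy: "x \<sim> a" "y \<sim> b" "x \<le> - y" "D = cls (x \<^bold>\<or> y)"
      unfolding cls_def[symmetric] by (auto simp: mem_cls)
    have "x \<sim> a1" "y \<sim> b1" using xy that sim_sym sim_trans by blast+
    then show "D = cls (a1 \<^bold>\<or> b1)" using xy that by (simp add: cls_eq_iff sim_sup)
  qed
  have "eplus bool_effalg x y \<noteq> None \<longleftrightarrow> x \<le> - y" for x y :: 'a
    by (simp add: bool_effalg_def inf_shunt)
  then have ex: "(\<exists>a1 \<in> cls a. \<exists>b1 \<in> cls b. eplus bool_effalg a1 b1 \<noteq> None) \<longleftrightarrow>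
      (\<exists>a1 b1. a1 \<sim> a \<and> b1 \<sim> b \<and> a1 \<le> - b1)"
    by (simp only: mem_cls Bex_def) blast
  have def: "eplus Q (cls a) (cls b) = (if \<exists>a1 b1. a1 \<sim> a \<and> b1 \<sim> b \<and> a1 \<le> - b1
      then Some (THE D. \<exists>a1 \<in> cls a. \<exists>b1 \<in> cls b. \<exists>c.
        eplus bool_effalg a1 b1 = Some c \<and> D = sim_rel G `` {c}) else None)"
    unfolding equot_def effalg.simps equot_plus_def ex ..
  show ?thesis
  proof (cases "\<exists>a1 b1. a1 \<sim> a \<and> b1 \<sim> b \<and> a1 \<le> - b1")
    case True
    have "eplus Q (cls a) (cls b) = Some (cls (a1 \<^bold>\<or> b1))"
      if "a1 \<sim> a" "b1 \<sim> b" "a1 \<le> - b1" for a1 b1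
      unfolding def if_P[OF True] the[OF that] ..
    then show ?thesis using True by (metis option.inject)
  next
    case False
    then show ?thesis unfolding def if_not_P[OF False] by blast
  qed
qed

section \<open>The effect algebra of classes\<close>

lemma effect_algebra_Q: "effect_algebra Q"
proof
  fix A B C
  assume "A \<in> carrier Q" "B \<in> carrier Q" and p: "eplus Q A B = Some C"
  then obtain a b where ab: "A = cls a" "B = cls b" by (auto simp: carrier_Q)
  show "C \<in> carrier Q" using p by (auto simp: carrier_Q ab eplus_Q)
  show "eplus Q B A = Some C"
    using p unfolding ab eplus_Q by (metis sup_commute le_uminus_commute)
next
  fix A B C D E
  assume "A \<in> carrier Q" "B \<in> carrier Q" "C \<in> carrier Q"
    and p: "eplus Q A B = Some D" "eplus Q D C = Some E"
  then obtain a b c where abc: "A = cls a" "B = cls b" "C = cls c" by (auto simp: carrier_Q)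
  obtain a1 b1 where 1: "a1 \<sim> a" "b1 \<sim> b" "a1 \<le> - b1" "D = cls (a1 \<^bold>\<or> b1)"
    using p(1) by (auto simp: abc eplus_Q)
  obtain d1 c1 where 2: "d1 \<sim> a1 \<^bold>\<or> b1" "c1 \<sim> c" "d1 \<le> - c1" "E = cls (d1 \<^bold>\<or> c1)"
    using p(2) by (auto simp: abc 1 eplus_Q)
  \<comment> \<open>\<open>d1\<close> is only equivalent to \<open>a1 \<or> b1\<close>; splitting it
    makes the three summands pairwise disjoint.\<close>
  obtain a2 b2 where 3: "a2 \<sim> a1" "b2 \<sim> b1" "a2 \<le> - b2" "d1 = a2 \<^bold>\<or> b2"
    using sim_sup_split[OF 2(1) 1(3)] .
  have 4: "a2 \<sim> a" "b2 \<sim> b" using 1 3 sim_trans by blast+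
  have "eplus Q B C = Some (cls (b2 \<^bold>\<or> c1))"
    unfolding abc eplus_Q using 2 3 4 by (intro exI[of _ b2] exI[of _ c1]) auto
  moreover have "eplus Q A (cls (b2 \<^bold>\<or> c1)) = Some E"
    unfolding abc eplus_Q using 2 3 4
    by (intro exI[of _ a2] exI[of _ "b2 \<^bold>\<or> c1"]) (auto simp: sup_assoc)
  ultimately show "\<exists>U. eplus Q B C = Some U \<and> eplus Q A U = Some E" by blast
next
  fix A assume "A \<in> carrier Q"
  then obtain a where a: "A = cls a" by (auto simp: carrier_Q)
  show "\<exists>!A'. A' \<in> carrier Q \<and> eplus Q A A' = Some (eone Q)"
  proof (rule ex1I[of _ "cls (- a)"])
    have "eplus Q A (cls (- a)) = Some (eone Q)"
      unfolding a eone_Q eplus_Q by (intro exI[of _ a] exI[of _ "- a"]) simp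
    then show "cls (- a) \<in> carrier Q \<and> eplus Q A (cls (- a)) = Some (eone Q)"
      by (simp add: carrier_Q)
  next
    fix X assume X: "X \<in> carrier Q \<and> eplus Q A X = Some (eone Q)"
    then obtain x where x: "X = cls x" by (auto simp: carrier_Q)
    obtain a1 x1 where 1: "a1 \<sim> a" "x1 \<sim> x" "a1 \<le> - x1" "top_class.top \<sim> a1 \<^bold>\<or> x1"
      using X unfolding a x eone_Q eplus_Q cls_eq_iff by auto
    \<comment> \<open>The class of the unit is a singleton, so the join of the representatives is
      the unit itself.\<close>
    then have "x1 = - a1" by (metis disjoint_complement_iff sim_top)
    then show "X = cls (- a)" unfolding x cls_eq_iff
      using 1 by (metis sim_uminus sim_sym sim_trans)
  qed
next
  fix A C assume "A \<in> carrier Q" and p: "eplus Q A (eone Q) = Some C"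
  then obtain a where a: "A = cls a" by (auto simp: carrier_Q)
  obtain a1 t where 1: "a1 \<sim> a" "t \<sim> top_class.top" "a1 \<le> - t"
    using p unfolding a eone_Q eplus_Q by auto
  then have "a1 = bot_class.bot" using sim_top sim_sym by (metis compl_top_eq bot_unique)
  then show "A = ezero Q" using 1 by (simp add: a ezero_Q cls_eq_iff sim_sym)
qed (auto simp: carrier_Q ezero_Q eone_Q)

section \<open>The order of the quotient\<close>

lemma le_Q: "le (eorder Q) (cls a) (cls b) \<longleftrightarrow> (\<exists>f\<in>G. f a \<le> b)"
proof
  assume "le (eorder Q) (cls a) (cls b)"
  then obtain c a1 c1 where 1: "a1 \<sim> a" "c1 \<sim> c" "a1 \<le> - c1" "b \<sim> a1 \<^bold>\<or> c1"
    by (auto simp: eorder_def carrier_Q eplus_Q cls_eq_iff)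
  \<comment> \<open>Splitting \<open>b\<close> itself along the sum yields a copy of
    \<open>a\<close> below \<open>b\<close>.\<close>
  then obtain a2 c2 where "a2 \<sim> a1" "b = a2 \<^bold>\<or> c2" using sim_sup_split by metis
  then show "\<exists>f\<in>G. f a \<le> b" using 1 by (metis sim_sym sim_trans simE sup_ge1)
next
  assume "\<exists>f\<in>G. f a \<le> b"
  then obtain f where f: "f \<in> G" "f a \<le> b" ..
  then have "eplus Q (cls a) (cls (b - f a)) = Some (cls b)" unfolding eplus_Q
    by (intro exI[of _ "f a"] exI[of _ "b - f a"])
      (simp add: le_sup_diff diff_le_uminus simI sim_sym)
  then show "le (eorder Q) (cls a) (cls b)" by (auto simp: eorder_def carrier_Q)
qed

lemma carrier_eorder [simp]: "carrier (eorder E) = carrier E"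
  and eq_eorder [simp]: "eq (eorder E) = (=)"
  by (simp_all add: eorder_def)

lemma partial_order_Q: "partial_order (eorder Q)"
proof
  fix X Y assume "X \<in> carrier (eorder Q)" "Y \<in> carrier (eorder Q)"
    and le: "le (eorder Q) X Y" "le (eorder Q) Y X"
  then obtain x y where xy: "X = cls x" "Y = cls y" by (auto simp: carrier_Q)
  obtain f g where f: "f \<in> G" "f x \<le> y" and g: "g \<in> G" "g y \<le> x"
    using le by (auto simp: xy le_Q)
  obtain g' where g': "g' \<in> G" "\<forall>x. g' (g x) = x" "\<forall>x. g (g' x) = x"
    by (rule inverse_mem[OF g(1)])
  obtain f' where f': "f' \<in> G" "\<forall>x. f' (f x) = x" "\<forall>x. f (f' x) = x"
    by (rule inverse_mem[OF f(1)])
  have "x \<le> f' y" using map_mono[OF f'(1) f(2)] f' by simp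
  moreover have y: "y \<le> g' x" using map_mono[OF g'(1) g(2)] g' by simp
  then have "f' y \<le> f' (g' x)" by (rule map_mono[OF f'(1)])
  \<comment> \<open>The chain \<open>x \<le> f' y \<le> f' (g' x)\<close> shows that
    \<open>f' \<circ> g'\<close> expands \<open>x\<close>, hence fixes it, and the chain
    collapses.\<close>
  moreover have "f' (g' x) = x"
    using not_expanding[OF comp_mem[OF f'(1) g'(1)], of x] calculation by simp
  ultimately have "f' y = x" by simp
  then show "eq (eorder Q) X Y"
    using simI[OF f'(1), of y] by (simp add: xy cls_eq_iff sim_sym)
next
  fix X Y Z
  assume "X \<in> carrier (eorder Q)" "Y \<in> carrier (eorder Q)" "Z \<in> carrier (eorder Q)"
    and le: "le (eorder Q) X Y" "le (eorder Q) Y Z"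
  then obtain x y z where xyz: "X = cls x" "Y = cls y" "Z = cls z" by (auto simp: carrier_Q)
  obtain f g where "f \<in> G" "f x \<le> y" "g \<in> G" "g y \<le> z"
    using le by (auto simp: xyz le_Q)
  then have "g \<circ> f \<in> G" "(g \<circ> f) x \<le> z" by (auto intro: comp_mem order_trans map_mono)
  then show "le (eorder Q) X Z" unfolding xyz le_Q by blast
next
  fix X assume "X \<in> carrier (eorder Q)"
  then obtain x where x: "X = cls x" by (auto simp: carrier_Q)
  show "le (eorder Q) X X" unfolding x le_Q by (rule bexI[OF _ id_mem]) simp
qed auto

lemma le_QI: "a \<le> b \<Longrightarrow> le (eorder Q) (cls a) (cls b)"
  unfolding le_Q by (rule bexI[OF _ id_mem]) simp

section \<open>Meets and joins of classes\<close>

lemma cls_maximal_representative: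
  assumes "A \<in> carrier Q" "B \<in> carrier Q"
  obtains a b where "A = cls a" "B = cls b" "a \<^bold>\<and> b \<in> max_elems (L_set G a b)"
proof -
  obtain a b0 where 1: "A = cls a" "B = cls b0" using assms by (auto simp: carrier_Q)
  obtain b where "b \<sim> b0" "a \<^bold>\<and> b \<in> max_elems (L_set G a b)" by (rule maximal_representative)
  then show ?thesis using that 1 by (metis cls_eq_iff)
qed

lemma greatest_Q:
  assumes "a \<^bold>\<and> b \<in> max_elems (L_set G a b)"
  shows "greatest (eorder Q) (cls (a \<^bold>\<and> b)) (Lower (eorder Q) {cls a, cls b})"
proof (rule greatest_LowerI)
  fix X assume X: "X \<in> Lower (eorder Q) {cls a, cls b}"
  then obtain x where x: "X = cls x" by (auto simp: Lower_def carrier_Q)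
  have "\<exists>f\<in>G. f x \<le> a" "\<exists>g\<in>G. g x \<le> b"
    using X by (simp_all add: Lower_def carrier_Q x le_Q)
  then show "le (eorder Q) X (cls (a \<^bold>\<and> b))"
    unfolding x le_Q using maximal_greatest[OF assms] by metis
next
  fix X assume "X \<in> {cls a, cls b}"
  then show "le (eorder Q) (cls (a \<^bold>\<and> b)) X" using le_QI by (metis inf_le1 inf_le2 insertE singletonD)
qed (simp_all add: carrier_Q)

lemma least_Q:
  assumes "a \<^bold>\<and> b \<in> max_elems (L_set G a b)"
  shows "least (eorder Q) (cls (a \<^bold>\<or> b)) (Upper (eorder Q) {cls a, cls b})"
proof (rule least_UpperI)
  fix X assume X: "X \<in> Upper (eorder Q) {cls a, cls b}"
  then obtain x where x: "X = cls x" by (auto simp: Upper_def carrier_Q)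
  have "\<exists>f\<in>G. f a \<le> x" "\<exists>g\<in>G. g b \<le> x"
    using X by (simp_all add: Upper_def carrier_Q x le_Q)
  then show "le (eorder Q) (cls (a \<^bold>\<or> b)) X"
    unfolding x le_Q using maximal_least[OF assms] by metis
next
  fix X assume "X \<in> {cls a, cls b}"
  then show "le (eorder Q) X (cls (a \<^bold>\<or> b))" using le_QI by (metis sup_ge1 sup_ge2 insertE singletonD)
qed (simp_all add: carrier_Q)

lemma lattice_Q: "lattice (eorder Q)"
proof (intro lattice.intro upper_semilattice.intro lower_semilattice.intro partial_order_Q
    upper_semilattice_axioms.intro lower_semilattice_axioms.intro)
  fix X Y assume "X \<in> carrier (eorder Q)" "Y \<in> carrier (eorder Q)"
  then have "X \<in> carrier Q" "Y \<in> carrier Q" by simp_all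
  then obtain a b where "X = cls a" "Y = cls b" "a \<^bold>\<and> b \<in> max_elems (L_set G a b)"
    by (rule cls_maximal_representative)
  then show "\<exists>S. least (eorder Q) S (Upper (eorder Q) {X, Y})"
    "\<exists>S. greatest (eorder Q) S (Lower (eorder Q) {X, Y})"
    using least_Q greatest_Q by blast+
qed

section \<open>Differences of classes and the MV identity\<close>

lemma eminus_Q:
  assumes "a \<le> b"
  shows "eminus Q (cls b) (cls a) = cls (b - a)"
  unfolding eminus_def
proof (rule the_equality)
  show "cls (b - a) \<in> carrier Q \<and> eplus Q (cls a) (cls (b - a)) = Some (cls b)"
    unfolding carrier_Q eplus_Q using assms
    by (intro conjI rangeI exI[of _ a] exI[of _ "b - a"])
      (simp_all add: le_sup_diff diff_le_uminus)
next
  fix X assume X: "X \<in> carrier Q \<and> eplus Q (cls a) X = Some (cls b)"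
  then obtain x where x: "X = cls x" by (auto simp: carrier_Q)
  obtain a1 x1 where 1: "a1 \<sim> a" "x1 \<sim> x" "a1 \<le> - x1" "b \<sim> a1 \<^bold>\<or> x1"
    using X by (auto simp: x eplus_Q cls_eq_iff)
  obtain a2 x2 where 2: "a2 \<sim> a1" "x2 \<sim> x1" "a2 \<le> - x2" "b = a2 \<^bold>\<or> x2"
    using sim_sup_split[OF 1(4,3)] .
  have x2: "x2 = b - a2" using 2 le_uminus_commute[of a2 x2]
    by (simp add: boolean_algebra_class.diff_eq inf_sup_distrib2 inf_absorb1)
  have "a2 \<sim> a" using 1 2 sim_trans by blast
  then obtain f where f: "f \<in> G" "a = f a2" by (rule simE)
  \<comment> \<open>Both \<open>a2\<close> and \<open>a\<close> lie below \<open>b\<close>, so they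
    can be matched with \<open>b\<close> fixed; then their differences from \<open>b\<close> are
    matched too.\<close>
  obtain h where h: "h \<in> G" "h a2 = a" "h b = b"
    using MVP1[OF f(1), of a2 b] f(2) 2(4) assms by auto
  then have "h x2 = b - a" by (simp add: x2 map_diff)
  then have "x2 \<sim> b - a" using simI[OF h(1)] by metis
  then show "X = cls (b - a)" unfolding x cls_eq_iff using 1 2 sim_sym sim_trans by metis
qed

theorem mv_effect_algebra_Q: "mv_effect_algebra Q"
proof (intro mv_effect_algebra.intro effect_algebra_Q mv_effect_algebra_axioms.intro lattice_Q)
  fix X Y assume XY: "X \<in> carrier Q" "Y \<in> carrier Q"
  interpret lattice "eorder Q" by (rule lattice_Q)
  obtain a b where ab: "X = cls a" "Y = cls b" and m: "a \<^bold>\<and> b \<in> max_elems (L_set G a b)"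
    using XY by (rule cls_maximal_representative)
  have "X \<squnion>\<^bsub>eorder Q\<^esub> Y = cls (a \<^bold>\<or> b)"
    using least_unique[OF sup_of_two_least least_Q[OF m]] XY by (simp add: ab join_def)
  moreover have "X \<sqinter>\<^bsub>eorder Q\<^esub> Y = cls (a \<^bold>\<and> b)"
    using greatest_unique[OF inf_of_two_greatest greatest_Q[OF m]] XY by (simp add: ab meet_def)
  \<comment> \<open>With one pair of representatives serving for both join and meet, the MV law
    reduces to this Boolean identity.\<close>
  moreover have "(a \<^bold>\<or> b) - a = b - a \<^bold>\<and> b"
    by (simp add: boolean_algebra_class.diff_eq inf_sup_distrib1 inf_sup_distrib2)
  ultimately show "eminus Q (X \<squnion>\<^bsub>eorder Q\<^esub> Y) X = eminus Q Y (X \<sqinter>\<^bsub>eorder Q\<^esub> Y)"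
    by (simp add: ab eminus_Q)
qed

end

theorem theorem3p9:
  fixes G :: "('a::boolean_algebra \<Rightarrow> 'a) set"
  assumes "mv_pair G"
  shows "effect_algebra_congruence bool_effalg (sim_rel G) \<and>
         mv_effect_algebra (equot bool_effalg (sim_rel G))"
  using mv_pair.congruence[OF assms] mv_pair.mv_effect_algebra_Q[OF assms] by simp

end
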